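(* Let $A<^*B$ be finite graphs with $A<^*_aB$. Then for every real $\varepsilon>0$ there is $k\in\mathbb N$ such that, with probability tending to $1$ as $n\to\infty$, for every one-to-one $f:A\to[n]$ we have $\mathcal G^{\varepsilon,k}_{A,B}(f,\mathcal M_n)=\emptyset$.
   Context: Fix an irrational real $\alpha\in(0,1)$. $\mathcal M_n$ is the random graph on $[n]=\{1,\dots,n\}$ in which each pair $\{i,j\}$, $i\neq j$, is an edge independently with probability $p_{|i-j|}$, where $p_\ell=\ell^{-\alpha}$ for $\ell>1$ and $p_1=p_2=2^{-\alpha}$. Graphs are finite simple graphs; $A\le^*B$ means $A$ is an induced subgraph of $B$, $A<^*B$ means also $A\ne B$. $\mathcal T$ is the set of $(A,B,\lambda)$ with $A\le^*B$ and $\lambda$ an equivalence relation on $B\setminus A$; $X\subseteq B$ is $\lambda$-closed if $x\in X\cap(B\setminus A)\Rightarrow x/\lambda\subseteq X$. $\mathbf v_\lambda(A,B)=|(B\setminus A)/\lambda|$; $\mathbf e_\lambda(A,B)$ = number of edges $e$ of $B$ with $e\not\subseteq A$ and $e\not\subseteq x/\lambda$ for all $x\in B\setminus A$; $\mathbf w_\lambda(A,B)=\mathbf v_\lambda(A,B)-\alpha\mathbf e_\lambda(A,B)$ (restricted $\lambda$ on intermediate $\lambda$-closed sets). $A<^*_cB$: $A<^*B$ and $\mathbf w_\lambda(A,B)<0$ for all $\lambda$ with $(A,B,\lambda)\in\mathcal T$. $A\le^*_iB$: $A\le^*B$ and $A'<^*_cB$ for all $A\le^*A'<^*B$; $<^*_i$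 is $\le^*_i$ with $A\ne B$. $A\le^*_sB$: $A\le^*B$ and no $A'$ with $A<^*_iA'\le^*B$; $<^*_s$ is $\le^*_s$ with $A\neq B$. $A<^*_aB$: $A\le^*B$ and not $A<^*_sB$. For a graph $M$ on $[n]$, one-to-one $f:A\to[n]$, $\varepsilon>0$, $k\in\mathbb N$: $\mathcal G^{\varepsilon,k}_{A,B}(f,M)$ is the set of sequences $\langle g_\ell:\ell<k\rangle$ with each $g_\ell:B\to[n]$ one-to-one extending $f$, mapping every edge of $B$ not contained in $A$ to an edge of $M$, $\mathrm{Rang}(g_{\ell_1})\cap\mathrm{Rang}(g_{\ell_2})=\mathrm{Rang}(f)$ for $\ell_1\neq\ell_2$, and $|g_\ell(x)-g_\ell(y)|\ge n^\varepsilon$ for $x\in B\setminus A$, $y\in A$. *)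

theory Defs
  imports "HOL-Probability.Probability"
begin

datatype 'a sgraph = SGraph (verts: "'a set") (edges: "'a set set")

definition finite_sgraph :: "'a sgraph \<Rightarrow> bool" where
  "finite_sgraph G \<longleftrightarrow> finite (verts G) \<and> edges G \<subseteq> {e. e \<subseteq> verts G \<and> card e = 2}"

definition le_ind :: "'a sgraph \<Rightarrow> 'a sgraph \<Rightarrow> bool" (infix \<open>\<le>\<^sup>*\<close> 50) where
  "A \<le>\<^sup>* B \<longleftrightarrow> verts A \<subseteq> verts B \<and> edges A = {e \<in> edges B. e \<subseteq> verts A}"

definition less_ind :: "'a sgraph \<Rightarrow> 'a sgraph \<Rightarrow> bool" (infix \<open><\<^sup>*\<close> 50) where
  "A <\<^sup>* B \<longleftrightarrow> A \<le>\<^sup>* B \<and> A \<noteq> B"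

definition new_verts :: "'a sgraph \<Rightarrow> 'a sgraph \<Rightarrow> 'a set" where
  "new_verts A B = verts B - verts A"

definition triples :: "('a sgraph \<times> 'a sgraph \<times> 'a rel) set" where
  "triples = {(A, B, lam). finite_sgraph A \<and> finite_sgraph B \<and> A \<le>\<^sup>* B \<and> equiv (new_verts A B) lam}"

definition v_num :: "'a rel \<Rightarrow> 'a sgraph \<Rightarrow> 'a sgraph \<Rightarrow> nat" where
  "v_num lam A B = card (new_verts A B // lam)"

definition e_num :: "'a rel \<Rightarrow> 'a sgraph \<Rightarrow> 'a sgraph \<Rightarrow> nat" where
  "e_num lam A B =
     card {e \<in> edges B. \<not> e \<subseteq> verts A \<and> (\<forall>x\<in>new_verts A B. \<not> e \<subseteq> lam `` {x})}"

definition weight :: "real \<Rightarrow> 'a rel \<Rightarrow> 'a sgraph \<Rightarrow> 'a sgraph \<Rightarrow> real" where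
  "weight \<alpha> lam A B = real (v_num lam A B) - \<alpha> * real (e_num lam A B)"

definition less_c :: "real \<Rightarrow> 'a sgraph \<Rightarrow> 'a sgraph \<Rightarrow> bool" where
  "less_c \<alpha> A B \<longleftrightarrow> A <\<^sup>* B \<and> (\<forall>lam. (A, B, lam) \<in> triples \<longrightarrow> weight \<alpha> lam A B < 0)"

definition le_i :: "real \<Rightarrow> 'a sgraph \<Rightarrow> 'a sgraph \<Rightarrow> bool" where
  "le_i \<alpha> A B \<longleftrightarrow> A \<le>\<^sup>* B \<and> (\<forall>A'. A \<le>\<^sup>* A' \<and> A' <\<^sup>* B \<longrightarrow> less_c \<alpha> A' B)"

definition less_i :: "real \<Rightarrow> 'a sgraph \<Rightarrow> 'a sgraph \<Rightarrow> bool" where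
  "less_i \<alpha> A B \<longleftrightarrow> le_i \<alpha> A B \<and> A \<noteq> B"

definition le_s :: "real \<Rightarrow> 'a sgraph \<Rightarrow> 'a sgraph \<Rightarrow> bool" where
  "le_s \<alpha> A B \<longleftrightarrow> A \<le>\<^sup>* B \<and> \<not> (\<exists>A'. less_i \<alpha> A A' \<and> A' \<le>\<^sup>* B)"

definition less_s :: "real \<Rightarrow> 'a sgraph \<Rightarrow> 'a sgraph \<Rightarrow> bool" where
  "less_s \<alpha> A B \<longleftrightarrow> le_s \<alpha> A B \<and> A \<noteq> B"

definition less_a :: "real \<Rightarrow> 'a sgraph \<Rightarrow> 'a sgraph \<Rightarrow> bool" where
  "less_a \<alpha> A B \<longleftrightarrow> A \<le>\<^sup>* B \<and> \<not> less_s \<alpha> A B"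

definition edge_prob :: "real \<Rightarrow> nat \<Rightarrow> real" where
  "edge_prob \<alpha> l = (if l = 1 then 2 powr (- \<alpha>) else real l powr (- \<alpha>))"

definition vertex_pairs :: "nat \<Rightarrow> nat set set" where
  "vertex_pairs n = {e. e \<subseteq> {1..n} \<and> card e = 2}"

text \<open>For a pair \<open>e = {i, j}\<close> the distance \<open>\<bar>i - j\<bar>\<close> is \<open>Max e - Min e\<close>.\<close>

definition random_graph :: "real \<Rightarrow> nat \<Rightarrow> nat sgraph pmf" where
  "random_graph \<alpha> n =
     map_pmf (\<lambda>X. SGraph {1..n} {e \<in> vertex_pairs n. X e})
       (Pi_pmf (vertex_pairs n) False (\<lambda>e. bernoulli_pmf (edge_prob \<alpha> (Max e - Min e))))"

definition far_extensions ::
  "real \<Rightarrow> nat \<Rightarrow> 'a sgraph \<Rightarrow> 'a sgraph \<Rightarrow> nat \<Rightarrow> ('a \<Rightarrow> nat) \<Rightarrow> nat sgraph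
    \<Rightarrow> (nat \<Rightarrow> 'a \<Rightarrow> nat) set" where
  "far_extensions \<epsilon> k A B n f M =
     {g \<in> {..<k} \<rightarrow>\<^sub>E (verts B \<rightarrow>\<^sub>E {1..n}).
        (\<forall>l<k. inj_on (g l) (verts B)
           \<and> (\<forall>x\<in>verts A. g l x = f x)
           \<and> (\<forall>e\<in>edges B. \<not> e \<subseteq> verts A \<longrightarrow> g l ` e \<in> edges M)
           \<and> (\<forall>x\<in>new_verts A B. \<forall>y\<in>verts A.
                \<bar>real (g l x) - real (g l y)\<bar> \<ge> real n powr \<epsilon>))
        \<and> (\<forall>l1<k. \<forall>l2<k. l1 \<noteq> l2 \<longrightarrow>
             g l1 ` verts B \<inter> g l2 ` verts B = f ` verts A)}"

end

theory Submission
  imports Defs "HOL-Real_Asymp.Real_Asymp"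
begin

text \<open>
  Since \<open>A\<close> is not strong in \<open>B\<close>, there is \<open>A'\<close> with \<open>A <\<^sub>i A' \<le>\<^sup>* B\<close>, and it suffices to rule
  out \<open>k\<close> disjoint far copies of \<open>A'\<close>. By disjointness these are independent events, so a
  union bound reduces everything to one deterministic estimate: for every \<open>f\<close>, the sum over far
  extensions \<open>g\<close> of \<open>f\<close> to \<open>A'\<close> of the product of the edge probabilities is at most
  \<open>n powr (- \<eta>)\<close> for some fixed \<open>\<eta> > 0\<close>.

  For a single \<open>g\<close>, run Kruskal's algorithm on the points \<open>g x\<close>, starting with \<open>A\<close> as one
  cluster. At every scale the current clusters form an intermediate set together with an
  equivalence relation \<open>\<lambda>\<close>, whose weight is negative, hence at most \<open>- \<delta>\<close>. Integrating over
  logarithmic scales, the product of \<open>d(e) powr (- \<alpha>)\<close> over all new edges is at most the product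
  of \<open>1 / d\<close> over the links of the spanning tree, times \<open>D powr (- \<delta>)\<close> for the longest link
  \<open>D\<close>, and \<open>D \<ge> n powr \<epsilon>\<close> because some link leaves \<open>A\<close>. Summing \<open>1 / d\<close> over positions
  costs only a logarithm per link.
\<close>

section \<open>Kruskal's algorithm on clusterings\<close>

text \<open>
  Clusterings are represented by colorings \<open>c\<close>. A coloring that is constant on \<open>A\<close> encodes the
  \<open>\<lambda>\<close>-closed set of vertices colored like \<open>A\<close>, with \<open>\<lambda>\<close> given by the other color classes.
\<close>

definition separated :: "'a set set \<Rightarrow> ('a \<Rightarrow> 'b) \<Rightarrow> 'a set set" where
  "separated E c = {e \<in> E. \<exists>x\<in>e. \<exists>y\<in>e. c x \<noteq> c y}"

text \<open>
  Here \<open>h\<close> is the logarithm of the distance and \<open>\<sigma>\<close> the logarithm of the current scale. Moving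
  from \<open>\<sigma>\<close> to the next merging scale \<open>\<tau>\<close> changes the two sides by \<open>(card L + \<delta>) * (\<tau> - \<sigma>)\<close>
  and \<open>\<alpha> * card (separated E c) * (\<tau> - \<sigma>)\<close>, which the weight condition compares.
\<close>

lemma kruskal_bound:
  fixes h :: "'a set \<Rightarrow> real" and c :: "'a \<Rightarrow> 'b"
  assumes V: "finite V" "V \<noteq> {}" and E: "finite E" "\<forall>e\<in>E. e \<subseteq> V \<and> card e = 2"
    and nonneg: "0 \<le> \<alpha>" "0 \<le> \<delta>"
    and weight: "\<forall>c :: 'a \<Rightarrow> 'b. (\<forall>x\<in>A. c x = c a) \<longrightarrow> (\<exists>x\<in>V. c x \<noteq> c a) \<longrightarrow>
      real (card (c ` V)) - 1 + \<delta> \<le> \<alpha> * real (card (separated E c))"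
    and "\<forall>x\<in>A. c x = c a"
    and "\<forall>x\<in>V. \<forall>y\<in>V. c x \<noteq> c y \<longrightarrow> \<sigma> \<le> h {x, y}"
  shows "\<exists>L. L \<subseteq> {e. e \<subseteq> V \<and> card e = 2} \<and> card L < card (c ` V)
    \<and> (\<forall>U. U \<noteq> {} \<and> U \<subset> V \<longrightarrow> (\<exists>x\<in>U. \<exists>y\<in>V - U. {x, y} \<in> L \<or> c x = c y))
    \<and> (\<forall>D. D \<le> \<sigma> \<or> (\<exists>e\<in>L. D \<le> h e) \<longrightarrow>
         \<delta> * (D - \<sigma>) + (\<Sum>e\<in>L. h e - \<sigma>) \<le> \<alpha> * (\<Sum>e\<in>separated E c. h e - \<sigma>))"
  using assms(8,9)
\<comment> \<open>Each step merges two color classes, so the number of colors drops by one while the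
  scale \<sigma> moves up.\<close>
proof (induction "card (c ` V)" arbitrary: c \<sigma> rule: less_induct)
  case less
  show ?case
  proof (cases "\<exists>x\<in>V. \<exists>y\<in>V. c x \<noteq> c y")
    case False
    have "separated E c = {}"
    proof -
      have "c x = c y" if "e \<in> E" "x \<in> e" "y \<in> e" for e x y
        using that False E(2)[rule_format, OF that(1)] by blast
      then show ?thesis unfolding separated_def by blast
    qed
    moreover have "\<delta> * (D - \<sigma>) \<le> 0" if "D \<le> \<sigma>" for D
      using that nonneg by (simp add: mult_nonneg_nonpos)
    moreover have "0 < card (c ` V)" using V by (simp add: card_gt_0_iff)
    moreover have "\<exists>x\<in>U. \<exists>y\<in>V - U. c x = c y" if "U \<noteq> {}" "U \<subset> V" for U
    proof -
      obtain x y where "x \<in> U" "y \<in> V - U" using \<open>U \<noteq> {}\<close> \<open>U \<subset> V\<close> by blast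
      then show ?thesis using False \<open>U \<subset> V\<close> by blast
    qed
    \<comment> \<open>With one color left no link is chosen, so only \<open>D \<le> \<sigma>\<close>
      is allowed, and this makes the \<delta> term nonpositive.\<close>
    ultimately show ?thesis by (intro exI[of _ "{}"]) simp
  next
    case True
    \<comment> \<open>A pair minimising \<open>h\<close> among the differently colored pairs is
      Kruskal's next link, and its value is the next scale \<tau>.\<close>
    define P where "P = {p \<in> V \<times> V. c (fst p) \<noteq> c (snd p)}"
    have P: "finite P" "P \<noteq> {}" using True V unfolding P_def by auto
    obtain p where p: "p \<in> P" "\<And>q. q \<in> P \<Longrightarrow> h {fst p, snd p} \<le> h {fst q, snd q}"
      using P arg_min_if_finite(1)[OF P, of "\<lambda>p. h {fst p, snd p}"]
        arg_min_least[OF P, of _ "\<lambda>p. h {fst p, snd p}"] by blast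
    obtain u v where uv: "p = (u, v)" by (cases p)
    have u: "u \<in> V" "v \<in> V" "c u \<noteq> c v" using p(1) uv unfolding P_def by auto
    define \<tau> where "\<tau> = h {u, v}"
    have min: "\<tau> \<le> h {x, y}" if "x \<in> V" "y \<in> V" "c x \<noteq> c y" for x y
      using p(2)[of "(x, y)"] that unfolding \<tau>_def uv P_def by simp
    have "\<sigma> \<le> \<tau>" using less.prems(2) u unfolding \<tau>_def by blast
    \<comment> \<open>The class of \<open>v\<close> takes the color of \<open>u\<close>. Vertices
      that still differ in color differed before, so \<tau> is a lower bound for their
      \<open>h\<close>.\<close>
    define c' where "c' = (\<lambda>x. if c x = c v then c u else c x)"
    have "c' ` V = c ` V - {c v}" using u unfolding c'_def by (auto split: if_splits)
    then have card': "card (c ` V) = Suc (card (c' ` V))"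
      using V u card_Suc_Diff1[of "c ` V" "c v"] by simp
    have c'A: "\<forall>x\<in>A. c' x = c' a" using less.prems(1) unfolding c'_def by simp
    have c'V: "\<forall>x\<in>V. \<forall>y\<in>V. c' x \<noteq> c' y \<longrightarrow> \<tau> \<le> h {x, y}"
      using min unfolding c'_def by metis
    have "card (c' ` V) < card (c ` V)" using card' by simp
    from less.hyps[OF this c'A c'V]
    obtain L where L: "L \<subseteq> {e. e \<subseteq> V \<and> card e = 2}" "card L < card (c' ` V)"
      and links: "\<forall>U. U \<noteq> {} \<and> U \<subset> V \<longrightarrow> (\<exists>x\<in>U. \<exists>y\<in>V - U. {x, y} \<in> L \<or> c' x = c' y)"
      and bound: "\<forall>D. D \<le> \<tau> \<or> (\<exists>e\<in>L. D \<le> h e) \<longrightarrow>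
         \<delta> * (D - \<tau>) + (\<Sum>e\<in>L. h e - \<tau>) \<le> \<alpha> * (\<Sum>e\<in>separated E c'. h e - \<tau>)"
      by (elim exE conjE) (rule that)
    have finL: "finite L" using finite_subset[OF L(1)] V by simp
    let ?L = "insert {u, v} L"
    have "u \<noteq> v" using u by auto
    then have subL: "?L \<subseteq> {e. e \<subseteq> V \<and> card e = 2}" using L(1) u by auto
    have cardL: "card ?L < card (c ` V)"
      using L(2) card' finL by (simp add: card_insert_if)
    \<comment> \<open>If \<open>U\<close> splits \<open>u\<close> from \<open>v\<close>, the new
      link crosses the cut. Otherwise the only new case is a pair whose colors became equal by the
      merge: its end on the side away from \<open>u\<close> and \<open>v\<close> has the old color
      of one of them and is paired with that one.\<close>
    have connL: "\<exists>x\<in>U. \<exists>y\<in>V - U. {x, y} \<in> ?L \<or> c x = c y" if U: "U \<noteq> {}" "U \<subset> V" for U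
    proof (cases "u \<in> U \<longleftrightarrow> v \<in> U")
      case False
      then show ?thesis using u by (cases "u \<in> U") (auto simp: insert_commute)
    next
      case same: True
      obtain x y where xy: "x \<in> U" "y \<in> V - U" "{x, y} \<in> L \<or> c' x = c' y"
        using links U by meson
      show ?thesis
      proof (cases "{x, y} \<in> L \<or> c x = c y")
        case True
        then show ?thesis using xy by blast
      next
        case False
        then have "c x \<in> {c u, c v}" "c y \<in> {c u, c v}"
          using xy(3) unfolding c'_def by (auto split: if_splits)
        then show ?thesis using same xy(1,2) u
          by (cases "u \<in> U") (metis DiffI insertE singletonD)+
      qed
    qed
    have boundL: "\<delta> * (D - \<sigma>) + (\<Sum>e\<in>?L. h e - \<sigma>) \<le> \<alpha> * (\<Sum>e\<in>separated E c. h e - \<sigma>)"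
      if D: "D \<le> \<sigma> \<or> (\<exists>e\<in>?L. D \<le> h e)" for D
    proof -
      \<comment> \<open>A \<open>D\<close> witnessed by the new link is at most \<tau>, so it falls
        under the first alternative of the induction hypothesis.\<close>
      have "D \<le> \<tau> \<or> (\<exists>e\<in>L. D \<le> h e)" using D \<open>\<sigma> \<le> \<tau>\<close> unfolding \<tau>_def by auto
      note IH = bound[rule_format, OF this]
      have finsep: "finite (separated E c)" using E unfolding separated_def by simp
      have long: "0 \<le> h e - \<tau>" if e: "e \<in> separated E c" for e
      proof -
        obtain x y where "e \<in> E" "x \<in> e" "y \<in> e" "c x \<noteq> c y"
          using e unfolding separated_def by blast
        moreover from this have "e = {x, y}" using E(2)[rule_format, of e]
          by (auto simp: card_2_iff)
        ultimately show ?thesis using min[of x y] E(2)[rule_format, of e] by auto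
      qed
      \<comment> \<open>At scale \<tau> the new link contributes
        \<open>h {u, v} - \<tau> = 0\<close>, whether or not it already was in
        \<open>L\<close>.\<close>
      have shiftL: "(\<Sum>e\<in>?L. h e - \<sigma>) = (\<Sum>e\<in>L. h e - \<tau>) + card ?L * (\<tau> - \<sigma>)"
      proof -
        have "(\<Sum>e\<in>?L. h e - \<sigma>) = (\<Sum>e\<in>?L. h e - \<tau>) + card ?L * (\<tau> - \<sigma>)"
          by (simp add: sum_subtractf algebra_simps)
        moreover have "(\<Sum>e\<in>?L. h e - \<tau>) = (\<Sum>e\<in>L. h e - \<tau>)"
          using finL by (simp add: sum.insert_if \<tau>_def)
        ultimately show ?thesis by simp
      qed
      have shiftE: "(\<Sum>e\<in>separated E c. h e - \<sigma>)
          = (\<Sum>e\<in>separated E c. h e - \<tau>) + card (separated E c) * (\<tau> - \<sigma>)"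
        by (simp add: sum_subtractf algebra_simps)
      \<comment> \<open>Edges that the merge stops separating have nonnegative terms at scale
        \<tau>, so including them only enlarges the right side.\<close>
      have "c x \<noteq> c y" if "c' x \<noteq> c' y" for x y using that unfolding c'_def by metis
      then have "separated E c' \<subseteq> separated E c" unfolding separated_def by blast
      then have "(\<Sum>e\<in>separated E c'. h e - \<tau>) \<le> (\<Sum>e\<in>separated E c. h e - \<tau>)"
        using long finsep by (intro sum_mono2) auto
      then have 1: "\<alpha> * (\<Sum>e\<in>separated E c'. h e - \<tau>) \<le> \<alpha> * (\<Sum>e\<in>separated E c. h e - \<tau>)"
        using nonneg by (simp add: mult_left_mono)
      have "\<exists>x\<in>V. c x \<noteq> c a" using u by metis
      with weight less.prems(1)
      have "real (card (c ` V)) - 1 + \<delta> \<le> \<alpha> * real (card (separated E c))" by blast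
      moreover have "real (card ?L) \<le> real (card (c ` V)) - 1" using cardL by linarith
      ultimately have "(real (card ?L) + \<delta>) * (\<tau> - \<sigma>) \<le> \<alpha> * real (card (separated E c)) * (\<tau> - \<sigma>)"
        using \<open>\<sigma> \<le> \<tau>\<close> by (intro mult_right_mono) auto
      with 1 IH show ?thesis unfolding shiftL shiftE by (simp add: algebra_simps)
    qed
    show ?thesis
      by (intro exI[of _ ?L] conjI subL cardL allI impI connL boundL) (elim conjE, assumption)+
  qed
qed

section \<open>Negative weights in terms of colorings\<close>

text \<open>Vertices colored like \<open>a\<close> induce an intermediate graph, and the other color
  classes are the classes of \<lambda>. The weight then compares the number of other colors with the
  number of separated edges, and \<open>less_i\<close> makes it negative at every intermediate graph
  other than \<open>B\<close>.\<close>

lemma negative_weight_of_coloring: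
  fixes c :: "'a \<Rightarrow> 'b"
  assumes fin: "finite_sgraph B" and i: "less_i \<alpha> A B" and a: "a \<in> verts A"
    and c: "\<forall>x\<in>verts A. c x = c a" "\<exists>x\<in>verts B. c x \<noteq> c a"
  shows "real (card (c ` verts B)) - 1 < \<alpha> * real (card (separated (edges B) c))"
proof -
  define S where "S = {x \<in> verts B. c x = c a}"
  define A' where "A' = SGraph S {e \<in> edges B. e \<subseteq> S}"
  define N where "N = verts B - S"
  define lam where "lam = {(x, y). x \<in> N \<and> y \<in> N \<and> c x = c y}"
  have AB: "A \<le>\<^sup>* B" and less_c: "\<And>A'. A \<le>\<^sup>* A' \<Longrightarrow> A' <\<^sup>* B \<Longrightarrow> less_c \<alpha> A' B"
    using i unfolding less_i_def le_i_def by auto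
  have AS: "verts A \<subseteq> S" using AB c unfolding le_ind_def S_def by auto
  have "A \<le>\<^sup>* A'" using AB AS unfolding A'_def le_ind_def by auto
  moreover have A'B: "A' \<le>\<^sup>* B" unfolding A'_def le_ind_def S_def by auto
  moreover have "A' \<noteq> B" using c(2) unfolding A'_def S_def by (metis (mono_tags, lifting) mem_Collect_eq sgraph.sel(1))
  ultimately have "less_c \<alpha> A' B" using less_c unfolding less_ind_def by blast
  moreover have N: "new_verts A' B = N" unfolding new_verts_def N_def A'_def by simp
  have "finite_sgraph A'" using fin unfolding finite_sgraph_def A'_def S_def by auto
  moreover have "equiv N lam" unfolding lam_def
    by (intro equivI refl_onI symI transI) auto
  ultimately have w: "weight \<alpha> lam A' B < 0"
    using fin A'B N unfolding less_c_def triples_def by auto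
  have finV: "finite (verts B)" using fin unfolding finite_sgraph_def by simp
  have lam: "lam `` {x} = {y \<in> N. c y = c x}" if "x \<in> N" for x
    using that unfolding lam_def by auto
  \<comment> \<open>The classes are the fibres of \<open>c\<close> on \<open>N\<close>, so they
    correspond one-to-one to the colors occurring there.\<close>
  have "N // lam = (\<lambda>l. {x \<in> N. c x = l}) ` c ` N"
    unfolding quotient_def using lam by (simp add: UNION_singleton_eq_range image_image)
  moreover have "inj_on (\<lambda>l. {x \<in> N. c x = l}) (c ` N)" by (auto intro!: inj_onI)
  ultimately have "v_num lam A' B = card (c ` N)"
    unfolding v_num_def N by (simp add: card_image)
  moreover have "c ` verts B = insert (c a) (c ` N)"
    using a AS unfolding N_def S_def by auto
  moreover have "c a \<notin> c ` N" unfolding N_def S_def by auto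
  ultimately have v: "real (v_num lam A' B) = real (card (c ` verts B)) - 1"
    using finV unfolding N_def by simp
  have "{e \<in> edges B. \<not> e \<subseteq> verts A' \<and> (\<forall>x\<in>N. \<not> e \<subseteq> lam `` {x})} = separated (edges B) c"
  proof -
    \<comment> \<open>An edge lies in \<open>S\<close> or in a single class exactly when its two
      ends share a color.\<close>
    have "\<not> e \<subseteq> S \<and> (\<forall>x\<in>N. \<not> e \<subseteq> lam `` {x}) \<longleftrightarrow> (\<exists>x\<in>e. \<exists>y\<in>e. c x \<noteq> c y)" if "e \<in> edges B" for e
    proof -
      have "e \<subseteq> verts B" "card e = 2" using fin that unfolding finite_sgraph_def by auto
      then obtain x y where e: "e = {x, y}" "x \<in> verts B" "y \<in> verts B"
        by (metis card_2_iff insert_subset)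
      have "(\<exists>x\<in>e. \<exists>y\<in>e. c x \<noteq> c y) \<longleftrightarrow> c x \<noteq> c y" unfolding e(1) by auto
      also have "\<dots> \<longleftrightarrow> \<not> e \<subseteq> S \<and> (\<forall>z\<in>N. \<not> e \<subseteq> lam `` {z})"
      proof (cases "c x = c y")
        case True
        then have "e \<subseteq> S \<or> x \<in> N \<and> e \<subseteq> {w \<in> N. c w = c x}"
          using e unfolding N_def S_def by auto
        then show ?thesis using True lam by blast
      next
        case False
        then have "\<not> e \<subseteq> S" using e unfolding S_def by auto
        moreover have "\<not> e \<subseteq> lam `` {z}" if "z \<in> N" for z
          using False lam[OF that] e(1) by auto
        ultimately show ?thesis using False by blast
      qed
      finally show ?thesis by blast
    qed
    then show ?thesis unfolding separated_def A'_def by auto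
  qed
  then have "e_num lam A' B = card (separated (edges B) c)" unfolding e_num_def N by simp
  with w v show ?thesis unfolding weight_def by simp
qed

text \<open>Over an empty \<open>A\<close>, putting all of \<open>B\<close> into one class gives
  weight 1, which is not negative. A vertex of \<open>A\<close> is wanted as the color of the
  initial cluster.\<close>

lemma less_i_verts_nonempty:
  assumes fin: "finite_sgraph B" and i: "less_i \<alpha> A B"
  shows "verts A \<noteq> {}"
proof
  assume empty: "verts A = {}"
  have AB: "A \<le>\<^sup>* B" "A \<noteq> B" and "less_c \<alpha> A B"
    using i unfolding less_i_def le_i_def le_ind_def less_ind_def by auto
  moreover have "edges A = {}" 
    using AB fin empty unfolding le_ind_def finite_sgraph_def by force
  have V: "verts B \<noteq> {}"
  proof
    assume "verts B = {}"
    moreover from this have "edges B = {}" using fin unfolding finite_sgraph_def by force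
    ultimately show False using AB(2) empty \<open>edges A = {}\<close> by (metis sgraph.expand)
  qed
  have N: "new_verts A B = verts B" using empty unfolding new_verts_def by simp
  define lam where "lam = verts B \<times> verts B"
  have "equiv (verts B) lam" unfolding lam_def by (intro equivI refl_onI symI transI) auto
  moreover have "finite_sgraph A" using empty \<open>edges A = {}\<close> unfolding finite_sgraph_def by simp
  ultimately have "weight \<alpha> lam A B < 0"
    using fin AB N unfolding less_c_def triples_def by auto
  moreover have "verts B // lam = {verts B}" using V unfolding quotient_def lam_def by auto
  moreover have "{e \<in> edges B. \<not> e \<subseteq> verts A \<and> (\<forall>x\<in>verts B. \<not> e \<subseteq> lam `` {x})} = {}"
  proof -
    have "e \<subseteq> lam `` {x}" if "e \<in> edges B" "x \<in> verts B" for e x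
      using fin that unfolding finite_sgraph_def lam_def by auto
    then show ?thesis using V by blast
  qed
  then have "e_num lam A B = 0" unfolding e_num_def N by (metis card.empty)
  ultimately show False unfolding weight_def v_num_def N by simp
qed

text \<open>The numbers of colors and of separated edges are bounded, so the gap in the strict
  inequality takes finitely many positive values; the least of them, or 1 if smaller, serves all
  colorings at once.\<close>

lemma uniform_weight_gap:
  assumes fin: "finite_sgraph B" and i: "less_i \<alpha> A B" and a: "a \<in> verts A"
  obtains \<delta> :: real where "\<delta> > 0"
    "\<forall>c :: 'a \<Rightarrow> 'b. (\<forall>x\<in>verts A. c x = c a) \<longrightarrow> (\<exists>x\<in>verts B. c x \<noteq> c a) \<longrightarrow>
      real (card (c ` verts B)) - 1 + \<delta> \<le> \<alpha> * real (card (separated (edges B) c))"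
proof -
  define gap where "gap = (\<lambda>(v :: nat, m :: nat). \<alpha> * real m - (real v - 1))"
  define Q where "Q = {q \<in> gap ` ({..card (verts B)} \<times> {..card (edges B)}). 0 < q}"
  have finV: "finite (verts B)" and finE: "finite (edges B)"
    using fin finite_subset[of "edges B" "Pow (verts B)"] unfolding finite_sgraph_def by auto
  have "finite Q" unfolding Q_def by simp
  show thesis
  proof (rule that)
    \<comment> \<open>The extra element 1 makes \<open>Min\<close> meaningful even for an empty
      \<open>Q\<close>.\<close>
    show "Min (insert 1 Q) > 0" using \<open>finite Q\<close> unfolding Q_def by (subst Min_gr_iff) auto
    have "real (card (c ` verts B)) - 1 + Min (insert 1 Q) \<le> \<alpha> * real (card (separated (edges B) c))"
      if c: "\<forall>x\<in>verts A. c x = c a" "\<exists>x\<in>verts B. c x \<noteq> c a" for c :: "'a \<Rightarrow> 'b"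
    proof -
      let ?q = "gap (card (c ` verts B), card (separated (edges B) c))"
      have "card (separated (edges B) c) \<le> card (edges B)"
        using finE unfolding separated_def by (intro card_mono) auto
      moreover have "0 < ?q"
        using negative_weight_of_coloring[OF fin i a c] unfolding gap_def by simp
      ultimately have "?q \<in> Q" unfolding Q_def using card_image_le[OF finV, of c] by blast
      then have "Min (insert 1 Q) \<le> ?q" using \<open>finite Q\<close> by (intro Min_le) auto
      then show ?thesis unfolding gap_def by simp
    qed
    then show "\<forall>c :: 'a \<Rightarrow> 'b. (\<forall>x\<in>verts A. c x = c a) \<longrightarrow> (\<exists>x\<in>verts B. c x \<noteq> c a) \<longrightarrow>
      real (card (c ` verts B)) - 1 + Min (insert 1 Q) \<le> \<alpha> * real (card (separated (edges B) c))"
      by blast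
  qed
qed

section \<open>Bounding the edge product by a link product\<close>

text \<open>The difference of \<open>Max\<close> and \<open>Min\<close> is the form in which
  \<open>random_graph\<close> passes distances to \<open>edge_prob\<close>.\<close>

definition edge_length :: "('a \<Rightarrow> nat) \<Rightarrow> 'a set \<Rightarrow> real" where
  "edge_length g e = real (Max (g ` e) - Min (g ` e))"

lemma edge_length_pair: "edge_length g {x, y} = \<bar>real (g x) - real (g y)\<bar>"
  unfolding edge_length_def by (auto simp: max_def min_def)

lemma edge_length_ge_1:
  assumes "card e = 2" "inj_on g e"
  shows "1 \<le> edge_length g e"
proof -
  obtain x y where e: "e = {x, y}" "x \<noteq> y" using assms(1) card_2_iff by metis
  then have "g x \<noteq> g y" using assms(2) by auto
  then show ?thesis unfolding e(1) edge_length_pair by linarith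
qed

text \<open>Lengths are natural numbers, and length 0 gives \<open>1 / 0 = 0\<close>. So the bound
  also covers the non-injective maps that enter the sums over positions.\<close>

lemma inverse_edge_length_le_1: "1 / edge_length g e \<le> 1"
  unfolding edge_length_def by (cases "Max (g ` e) - Min (g ` e)") auto

lemma inverse_edge_length_nonneg: "0 \<le> 1 / edge_length g e"
  unfolding edge_length_def by simp

text \<open>For \<open>A \<subseteq> V\<close> this says that every vertex of \<open>V\<close> is
  reachable from \<open>A\<close> along \<open>L\<close>. The form by cuts lets a set grow from
  \<open>A\<close> to \<open>V\<close> one vertex at a time.\<close>

definition connecting :: "'a set \<Rightarrow> 'a set \<Rightarrow> 'a set set \<Rightarrow> bool" where
  "connecting A V L \<longleftrightarrow> L \<subseteq> {e. e \<subseteq> V \<and> card e = 2} \<and>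
     (\<forall>U. A \<subseteq> U \<and> U \<subset> V \<longrightarrow> (\<exists>x\<in>U. \<exists>y\<in>V - U. {x, y} \<in> L))"

text \<open>The Kruskal bound is applied to logarithms of lengths, starting at \<sigma> = 0, and
  then exponentiated; the \<delta> term turns into the power of \<open>n\<close>.\<close>

lemma edge_product_le_link_product:
  fixes A B :: "'a sgraph"
  assumes fin: "finite_sgraph B" and i: "less_i \<alpha> A B" and nonneg: "0 \<le> \<alpha>" "0 \<le> \<delta>"
    and a: "a \<in> verts A"
    and weight: "\<forall>c :: 'a \<Rightarrow> 'a. (\<forall>x\<in>verts A. c x = c a) \<longrightarrow> (\<exists>x\<in>verts B. c x \<noteq> c a) \<longrightarrow>
      real (card (c ` verts B)) - 1 + \<delta> \<le> \<alpha> * real (card (separated (edges B) c))"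
    and inj: "inj_on g (verts B)" and n: "1 \<le> n"
    and far: "\<forall>x\<in>new_verts A B. \<forall>y\<in>verts A. real n powr \<epsilon> \<le> \<bar>real (g x) - real (g y)\<bar>"
  shows "\<exists>L. connecting (verts A) (verts B) L \<and>
    (\<Prod>e\<in>{e \<in> edges B. \<not> e \<subseteq> verts A}. edge_length g e powr (- \<alpha>))
      \<le> real n powr (- (\<epsilon> * \<delta>)) * (\<Prod>e\<in>L. 1 / edge_length g e)"
proof -
  let ?V = "verts B" and ?E = "edges B"
  \<comment> \<open>\<open>A\<close> starts as one cluster of color \<open>a\<close>, every other
    vertex as a cluster of its own.\<close>
  define c where "c = (\<lambda>x. if x \<in> verts A then a else x)"
  define h where "h = (\<lambda>e. ln (edge_length g e))"
  have AB: "A \<le>\<^sup>* B" "A \<noteq> B" using i unfolding less_i_def le_i_def by auto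
  have AV: "verts A \<subseteq> ?V" using AB unfolding le_ind_def by simp
  have E: "\<forall>e\<in>?E. e \<subseteq> ?V \<and> card e = 2" and finV: "finite ?V" and finE: "finite ?E"
    using fin finite_subset[of "edges B" "Pow (verts B)"] unfolding finite_sgraph_def by auto
  have "verts A \<noteq> ?V"
  proof
    assume eq: "verts A = ?V"
    then have "edges A = ?E" using AB(1) E unfolding le_ind_def by auto
    then show False using eq AB(2) by (metis sgraph.expand)
  qed
  have len: "1 \<le> edge_length g e" if "e \<subseteq> ?V" "card e = 2" for e
    using edge_length_ge_1 inj_on_subset[OF inj] that by blast
  have cA: "\<forall>x\<in>verts A. c x = c a" using a unfolding c_def by simp
  have hge: "\<forall>x\<in>?V. \<forall>y\<in>?V. c x \<noteq> c y \<longrightarrow> 0 \<le> h {x, y}"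
  proof (intro ballI impI)
    fix x y assume xy: "x \<in> ?V" "y \<in> ?V" "c x \<noteq> c y"
    then have "x \<noteq> y" by blast
    with xy have "1 \<le> edge_length g {x, y}" by (intro len) auto
    then show "0 \<le> h {x, y}" unfolding h_def by simp
  qed
  have "?V \<noteq> {}" using a AV by blast
  from kruskal_bound[OF finV \<open>?V \<noteq> {}\<close> finE E nonneg weight cA hge]
  obtain L where L: "L \<subseteq> {e. e \<subseteq> ?V \<and> card e = 2}"
      and links: "\<forall>U. U \<noteq> {} \<and> U \<subset> ?V \<longrightarrow> (\<exists>x\<in>U. \<exists>y\<in>?V - U. {x, y} \<in> L \<or> c x = c y)"
      and bound: "\<forall>D. D \<le> 0 \<or> (\<exists>e\<in>L. D \<le> h e) \<longrightarrow>
         \<delta> * (D - 0) + (\<Sum>e\<in>L. h e - 0) \<le> \<alpha> * (\<Sum>e\<in>separated ?E c. h e - 0)"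
    by (elim exE conjE) (rule that)
  have conn: "\<exists>x\<in>U. \<exists>y\<in>?V - U. {x, y} \<in> L" if U: "verts A \<subseteq> U" "U \<subset> ?V" for U
  proof -
    obtain x y where xy: "x \<in> U" "y \<in> ?V - U" "{x, y} \<in> L \<or> c x = c y"
      using links a U by (metis empty_iff subsetD)
    \<comment> \<open>For a cut containing \<open>A\<close> the alternative \<open>c x = c y\<close>
      is impossible: the color of \<open>x\<close> lies in \<open>U\<close>, that of
      \<open>y\<close> is \<open>y\<close> itself.\<close>
    then have "c x \<in> U" "c y = y" using a U unfolding c_def by auto
    then show ?thesis using xy by auto
  qed
  then have connL: "connecting (verts A) ?V L" using L unfolding connecting_def by blast
  \<comment> \<open>The cut at \<open>verts A\<close> yields a link leaving \<open>A\<close>. Its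
    length is at least \<open>n powr \<epsilon>\<close>, so \<open>D = \<epsilon> * ln n\<close> is
    admissible.\<close>
  have "verts A \<subset> ?V" using AV \<open>verts A \<noteq> ?V\<close> by blast
  from conn[OF order.refl this] obtain x y where xy: "x \<in> verts A" "y \<in> ?V - verts A" "{x, y} \<in> L"
    by blast
  have "real n powr \<epsilon> \<le> edge_length g {x, y}"
    using far xy unfolding new_verts_def edge_length_pair by (metis abs_minus_commute)
  moreover have "0 < real n powr \<epsilon>" using n by simp
  ultimately have "ln (real n powr \<epsilon>) \<le> h {x, y}"
    unfolding h_def by (subst ln_le_cancel_iff) linarith+
  then have "\<epsilon> * ln n \<le> h {x, y}" using n by simp
  then have main: "\<delta> * (\<epsilon> * ln n) + (\<Sum>e\<in>L. h e) \<le> \<alpha> * (\<Sum>e\<in>separated ?E c. h e)"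
    using bound[rule_format, of "\<epsilon> * ln n"] xy(3) by auto
  have sep: "separated ?E c = {e \<in> ?E. \<not> e \<subseteq> verts A}"
  proof -
    have "(\<exists>x\<in>e. \<exists>y\<in>e. c x \<noteq> c y) \<longleftrightarrow> \<not> e \<subseteq> verts A" if "e \<in> ?E" for e
    proof -
      have "card e = 2" using E that by blast
      then obtain x y where "e = {x, y}" "x \<noteq> y" using card_2_iff by metis
      then show ?thesis using a unfolding c_def by auto
    qed
    then show ?thesis unfolding separated_def by blast
  qed
  have "(\<Prod>e\<in>{e \<in> ?E. \<not> e \<subseteq> verts A}. edge_length g e powr (- \<alpha>))
      = (\<Prod>e\<in>separated ?E c. exp (- \<alpha> * h e))"
    unfolding sep
  proof (intro prod.cong refl)
    fix e assume "e \<in> {e \<in> ?E. \<not> e \<subseteq> verts A}"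
    then have "1 \<le> edge_length g e" using len E by blast
    then show "edge_length g e powr (- \<alpha>) = exp (- \<alpha> * h e)" unfolding h_def powr_def by simp
  qed
  also have "\<dots> = exp (- \<alpha> * (\<Sum>e\<in>separated ?E c. h e))"
    using finE unfolding sep by (simp add: exp_sum sum_distrib_left)
  also have "\<dots> \<le> exp (- (\<delta> * (\<epsilon> * ln n)) - (\<Sum>e\<in>L. h e))" using main by simp
  also have "\<dots> = exp (- (\<delta> * (\<epsilon> * ln n))) * exp (\<Sum>e\<in>L. - h e)"
    by (simp add: sum_negf exp_add[symmetric])
  also have "exp (\<Sum>e\<in>L. - h e) = (\<Prod>e\<in>L. exp (- h e))"
    using finite_subset[OF L] finV by (simp add: exp_sum)
  also have "\<dots> = (\<Prod>e\<in>L. 1 / edge_length g e)"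
  proof (intro prod.cong refl)
    fix e assume "e \<in> L"
    then have "1 \<le> edge_length g e" using len L by blast
    then show "exp (- h e) = 1 / edge_length g e" unfolding h_def
      by (simp add: exp_minus inverse_eq_divide)
  qed
  also have "exp (- (\<delta> * (\<epsilon> * ln n))) = real n powr (- (\<epsilon> * \<delta>))"
    using n unfolding powr_def by (simp add: mult_ac)
  finally show ?thesis using connL by blast
qed

section \<open>Summing the link product over positions\<close>

text \<open>Each side of \<open>i\<close> contributes at most one harmonic sum, and the term
  \<open>j = i\<close> is \<open>1 / 0 = 0\<close>.\<close>

lemma sum_inverse_distance_le_harm:
  assumes i: "i \<in> {1..n}"
  shows "(\<Sum>j\<in>{1..n}. 1 / \<bar>real i - real j\<bar>) \<le> 2 * harm n"
proof -
  have "{1..n} = {1..<i} \<union> {i<..n} \<union> {i}" using i by auto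
  then have "(\<Sum>j\<in>{1..n}. 1 / \<bar>real i - real j\<bar>)
      = (\<Sum>j\<in>{1..<i} \<union> {i<..n} \<union> {i}. 1 / \<bar>real i - real j\<bar>)" by simp
  also have "\<dots> = (\<Sum>j\<in>{1..<i}. 1 / \<bar>real i - real j\<bar>) + (\<Sum>j\<in>{i<..n}. 1 / \<bar>real i - real j\<bar>)"
    by (subst sum.union_disjoint; (subst sum.union_disjoint)?) auto
  also have "(\<Sum>j\<in>{1..<i}. 1 / \<bar>real i - real j\<bar>) = (\<Sum>m\<in>{1..<i}. inverse (real m))"
    by (rule sum.reindex_bij_witness[of _ "\<lambda>m. i - m" "\<lambda>j. i - j"])
       (auto simp: inverse_eq_divide)
  also have "\<dots> \<le> harm n" unfolding harm_def using i by (intro sum_mono2) auto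
  also have "(\<Sum>j\<in>{i<..n}. 1 / \<bar>real i - real j\<bar>) = (\<Sum>m\<in>{1..n - i}. inverse (real m))"
    by (rule sum.reindex_bij_witness[of _ "\<lambda>m. i + m" "\<lambda>j. j - i"])
       (auto simp: inverse_eq_divide)
  also have "\<dots> \<le> harm n" unfolding harm_def by (intro sum_mono2) auto
  finally show ?thesis by simp
qed

text \<open>Starting from \<open>A\<close>, connectedness always supplies a link from the placed
  vertices to a new one. Summing its inverse length over the position of the new vertex costs a
  factor \<open>2 * harm n\<close>.\<close>

lemma sum_link_product_le:
  assumes V: "finite V" and AV: "A \<subseteq> V" and L: "connecting A V L" and f: "f \<in> A \<rightarrow> {1..n}"
  shows "(\<Sum>g\<in>PiE V (\<lambda>x. if x \<in> A then {f x} else {1..n}). \<Prod>e\<in>L. 1 / edge_length g e)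
    \<le> (2 * harm n) ^ card (V - A)"
proof -
  define T where "T = (\<lambda>x. if x \<in> A then {f x} else {1..n})"
  \<comment> \<open>\<open>F U\<close> is the sum in which only the vertices of \<open>U\<close> are
    placed and only the links inside \<open>U\<close> are counted.\<close>
  define F where "F = (\<lambda>U. \<Sum>g\<in>PiE U T. \<Prod>e\<in>{e \<in> L. e \<subseteq> U}. 1 / edge_length g e)"
  have Lsub: "L \<subseteq> {e. e \<subseteq> V \<and> card e = 2}" using L unfolding connecting_def by blast
  have finL: "finite L" using finite_subset[OF Lsub] V by simp
  have T: "T x \<subseteq> {1..n}" for x using f unfolding T_def by auto
  have step: "F (insert y U) \<le> 2 * harm n * F U"
    if U: "U \<subseteq> V" "A \<subseteq> U" and xy: "x \<in> U" "y \<in> V - U" "{x, y} \<in> L" for U x y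
  proof -
    have Ty: "T y = {1..n}" using xy U unfolding T_def by auto
    have "y \<notin> U" using xy by blast
    have "F (insert y U) = (\<Sum>(j, g)\<in>T y \<times> PiE U T. \<Prod>e\<in>{e \<in> L. e \<subseteq> insert y U}. 1 / edge_length (g(y := j)) e)"
      unfolding F_def PiE_insert_eq
      by (subst sum.reindex[OF inj_combinator[OF \<open>y \<notin> U\<close>]]) (simp add: o_def case_prod_unfold)
    also have "\<dots> \<le> (\<Sum>(j, g)\<in>T y \<times> PiE U T.
        1 / \<bar>real (g x) - real j\<bar> * (\<Prod>e\<in>{e \<in> L. e \<subseteq> U}. 1 / edge_length g e))"
    proof (intro sum_mono, clarify)
      fix j and g :: "'a \<Rightarrow> nat"
      let ?g = "g(y := j)"
      have "(\<Prod>e\<in>{e \<in> L. e \<subseteq> insert y U}. 1 / edge_length ?g e)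
          \<le> (\<Prod>e\<in>insert {x, y} {e \<in> L. e \<subseteq> U}. 1 / edge_length ?g e)"
      proof -
        let ?R = "insert {x, y} {e \<in> L. e \<subseteq> U}"
        \<comment> \<open>Among the links that \<open>y\<close> brings in, only
          \<open>{x, y}\<close> is kept; the others have factors at most 1.\<close>
        have sub: "?R \<subseteq> {e \<in> L. e \<subseteq> insert y U}" using xy by auto
        have "(\<Prod>e\<in>{e \<in> L. e \<subseteq> insert y U}. 1 / edge_length ?g e)
          = (\<Prod>e\<in>{e \<in> L. e \<subseteq> insert y U} - ?R. 1 / edge_length ?g e) * (\<Prod>e\<in>?R. 1 / edge_length ?g e)"
          using finL by (intro prod.subset_diff[OF sub]) simp
        also have "\<dots> \<le> 1 * (\<Prod>e\<in>?R. 1 / edge_length ?g e)"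
          by (intro mult_right_mono prod_le_1 prod_nonneg)
            (use inverse_edge_length_le_1 inverse_edge_length_nonneg in blast)+
        finally show ?thesis by simp
      qed
      also have "\<dots> = 1 / edge_length ?g {x, y} * (\<Prod>e\<in>{e \<in> L. e \<subseteq> U}. 1 / edge_length ?g e)"
        using finL \<open>y \<notin> U\<close> by (subst prod.insert) auto
      also have "edge_length ?g {x, y} = \<bar>real (g x) - real j\<bar>"
        using xy unfolding edge_length_pair by auto
      also have "(\<Prod>e\<in>{e \<in> L. e \<subseteq> U}. 1 / edge_length ?g e) = (\<Prod>e\<in>{e \<in> L. e \<subseteq> U}. 1 / edge_length g e)"
      proof (intro prod.cong refl)
        fix e assume "e \<in> {e \<in> L. e \<subseteq> U}"
        then have "?g ` e = g ` e" using \<open>y \<notin> U\<close> by (intro image_cong) auto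
        then show "1 / edge_length ?g e = 1 / edge_length g e" unfolding edge_length_def by simp
      qed
      finally show "(\<Prod>e\<in>{e \<in> L. e \<subseteq> insert y U}. 1 / edge_length ?g e)
        \<le> 1 / \<bar>real (g x) - real j\<bar> * (\<Prod>e\<in>{e \<in> L. e \<subseteq> U}. 1 / edge_length g e)" .
    qed
    also have "\<dots> = (\<Sum>g\<in>PiE U T. (\<Sum>j\<in>T y. 1 / \<bar>real (g x) - real j\<bar>)
        * (\<Prod>e\<in>{e \<in> L. e \<subseteq> U}. 1 / edge_length g e))"
      by (subst sum.cartesian_product[symmetric], subst sum.swap) (simp only: sum_distrib_right)
    also have "\<dots> \<le> (\<Sum>g\<in>PiE U T. 2 * harm n * (\<Prod>e\<in>{e \<in> L. e \<subseteq> U}. 1 / edge_length g e))"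
    proof (intro sum_mono mult_right_mono prod_nonneg)
      fix g assume "g \<in> PiE U T"
      then have "g x \<in> {1..n}" using T PiE_mem[of g U T x] xy by blast
      then show "(\<Sum>j\<in>T y. 1 / \<bar>real (g x) - real j\<bar>) \<le> 2 * harm n"
        unfolding Ty by (rule sum_inverse_distance_le_harm)
    qed (rule inverse_edge_length_nonneg)
    also have "\<dots> = 2 * harm n * F U" unfolding F_def by (simp only: sum_distrib_left)
    finally show ?thesis .
  qed
  have "F V \<le> (2 * harm n) ^ card (V - U) * F U" if "A \<subseteq> U" "U \<subseteq> V" for U
    using that
  proof (induction "card (V - U)" arbitrary: U)
    case 0
    then have "U = V" using V by auto
    then show ?case by simp
  next
    case (Suc m)
    then have "U \<subset> V" by auto
    with L Suc.prems obtain x y where xy: "x \<in> U" "y \<in> V - U" "{x, y} \<in> L"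
      unfolding connecting_def by blast
    have "V - insert y U = (V - U) - {y}" by blast
    then have m: "m = card (V - insert y U)" using Suc.hyps(2) xy V by simp
    have "F V \<le> (2 * harm n) ^ m * F (insert y U)"
      using Suc.hyps(1)[OF m] Suc.prems xy m by auto
    also have "\<dots> \<le> (2 * harm n) ^ m * (2 * harm n * F U)"
      using step[OF Suc.prems(2,1) xy] by (intro mult_left_mono) (simp_all add: harm_nonneg)
    finally show ?case unfolding Suc.hyps(2)[symmetric] by (simp add: mult_ac)
  qed
  from this[of A] AV have "F V \<le> (2 * harm n) ^ card (V - A) * F A" by simp
  \<comment> \<open>\<open>A\<close> admits a single placement, the one given by \<open>f\<close>,
    and its product is at most 1.\<close>
  also have "F A \<le> 1"
  proof -
    have "PiE A T = PiE A (\<lambda>x. {f x})" unfolding T_def by (intro PiE_cong) auto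
    then have "card (PiE A T) = 1" using finite_subset[OF AV V] by (simp add: card_PiE)
    moreover have "F A \<le> (\<Sum>g\<in>PiE A T. 1)" unfolding F_def
      by (intro sum_mono prod_le_1) (use inverse_edge_length_le_1 inverse_edge_length_nonneg in blast)
    ultimately show ?thesis by simp
  qed
  then have "(2 * harm n) ^ card (V - A) * F A \<le> (2 * harm n) ^ card (V - A)"
    by (intro mult_left_le) (auto simp: harm_nonneg)
  finally have "F V \<le> (2 * harm n) ^ card (V - A)" .
  moreover have "{e \<in> L. e \<subseteq> V} = L" using Lsub by blast
  ultimately show ?thesis unfolding F_def T_def by simp
qed

section \<open>Probabilities in the random graph\<close>

lemma edge_prob_nonneg: "0 \<le> edge_prob \<alpha> l"
  unfolding edge_prob_def by simp

lemma edge_prob_le_powr: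
  assumes "0 \<le> \<alpha>" "1 \<le> l"
  shows "edge_prob \<alpha> l \<le> real l powr (- \<alpha>)"
  using assms powr_mono[of "- \<alpha>" 0 2] unfolding edge_prob_def by simp

lemma edge_prob_le_1:
  assumes "0 \<le> \<alpha>"
  shows "edge_prob \<alpha> l \<le> 1"
proof (cases "l = 0")
  case True
  then show ?thesis by (simp add: edge_prob_def)
next
  case False
  then have "edge_prob \<alpha> l \<le> real l powr (- \<alpha>)" using assms by (intro edge_prob_le_powr) auto
  also have "\<dots> \<le> real l powr 0" using assms False by (intro powr_mono) auto
  finally show ?thesis using False by simp
qed

lemma finite_vertex_pairs: "finite (vertex_pairs n)"
  unfolding vertex_pairs_def by simp

text \<open>The event forces the coordinates in \<open>Z\<close> to \<open>True\<close> and leaves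
  the others free, so it is a product set under \<open>Pi_pmf\<close>.\<close>

lemma prob_edges_present:
  assumes \<alpha>: "0 \<le> \<alpha>" and Z: "Z \<subseteq> vertex_pairs n"
  shows "measure_pmf.prob (random_graph \<alpha> n) {M. Z \<subseteq> edges M} = (\<Prod>e\<in>Z. edge_prob \<alpha> (Max e - Min e))"
proof -
  let ?S = "\<lambda>e. if e \<in> Z then {True} else UNIV"
  let ?p = "\<lambda>e. bernoulli_pmf (edge_prob \<alpha> (Max e - Min e))"
  have "(\<lambda>X. SGraph {1..n} {e \<in> vertex_pairs n. X e}) -` {M. Z \<subseteq> edges M} = Pi (vertex_pairs n) ?S"
    using Z by (auto simp: Pi_def split: if_splits)
  then have "measure_pmf.prob (random_graph \<alpha> n) {M. Z \<subseteq> edges M}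
      = measure_pmf.prob (Pi_pmf (vertex_pairs n) False ?p) (Pi (vertex_pairs n) ?S)"
    unfolding random_graph_def by simp
  also have "\<dots> = (\<Prod>e\<in>vertex_pairs n. measure_pmf.prob (?p e) (?S e))"
    by (rule measure_Pi_pmf_Pi[OF finite_vertex_pairs])
  also have "\<dots> = (\<Prod>e\<in>vertex_pairs n. if e \<in> Z then edge_prob \<alpha> (Max e - Min e) else 1)"
    using edge_prob_nonneg edge_prob_le_1[OF \<alpha>]
    by (intro prod.cong refl) (auto simp: measure_pmf_single)
  also have "\<dots> = (\<Prod>e\<in>Z. edge_prob \<alpha> (Max e - Min e))"
    using Z finite_vertex_pairs[of n] by (simp add: prod.If_cases Int_absorb1)
  finally show ?thesis .
qed

text \<open>These are the conditions that \<open>far_extensions\<close> puts on one component alone,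
  without those involving the graph \<open>M\<close>.\<close>

definition single_extensions ::
  "real \<Rightarrow> nat \<Rightarrow> 'a sgraph \<Rightarrow> 'a sgraph \<Rightarrow> ('a \<Rightarrow> nat) \<Rightarrow> ('a \<Rightarrow> nat) set" where
  "single_extensions \<epsilon> n A B f = {g \<in> verts B \<rightarrow>\<^sub>E {1..n}. inj_on g (verts B) \<and> (\<forall>x\<in>verts A. g x = f x)
     \<and> (\<forall>x\<in>new_verts A B. \<forall>y\<in>verts A. real n powr \<epsilon> \<le> \<bar>real (g x) - real (g y)\<bar>)}"

text \<open>For \<open>g\<close> in \<open>single_extensions\<close> this is the probability that
  \<open>g\<close> maps every edge of \<open>B\<close> not inside \<open>A\<close> to an edge of the
  random graph.\<close>

definition extension_prob :: "real \<Rightarrow> 'a sgraph \<Rightarrow> 'a sgraph \<Rightarrow> ('a \<Rightarrow> nat) \<Rightarrow> real" where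
  "extension_prob \<alpha> A B g =
     (\<Prod>e\<in>{e \<in> edges B. \<not> e \<subseteq> verts A}. edge_prob \<alpha> (Max (g ` e) - Min (g ` e)))"

lemma extension_prob_nonneg: "0 \<le> extension_prob \<alpha> A B g"
  unfolding extension_prob_def by (intro prod_nonneg edge_prob_nonneg ballI)

text \<open>The link set that bounds the edge product depends on \<open>g\<close>. Summing over all
  connecting link sets removes this dependence, at the cost of a factor independent of
  \<open>n\<close>.\<close>

lemma sum_extension_prob_le:
  fixes A B :: "'a sgraph"
  assumes fin: "finite_sgraph B" and i: "less_i \<alpha> A B" and nonneg: "0 \<le> \<alpha>" "0 \<le> \<delta>"
    and a: "a \<in> verts A"
    and weight: "\<forall>c :: 'a \<Rightarrow> 'a. (\<forall>x\<in>verts A. c x = c a) \<longrightarrow> (\<exists>x\<in>verts B. c x \<noteq> c a) \<longrightarrow>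
      real (card (c ` verts B)) - 1 + \<delta> \<le> \<alpha> * real (card (separated (edges B) c))"
    and n: "1 \<le> n" and f: "f \<in> verts A \<rightarrow> {1..n}"
  shows "(\<Sum>g\<in>single_extensions \<epsilon> n A B f. extension_prob \<alpha> A B g)
    \<le> real (card (Pow (Pow (verts B)))) * (real n powr (- (\<epsilon> * \<delta>)) * (2 * harm n) ^ card (new_verts A B))"
proof -
  let ?V = "verts B" and ?S = "single_extensions \<epsilon> n A B f"
  let ?T = "PiE ?V (\<lambda>x. if x \<in> verts A then {f x} else {1..n})"
  define \<Lambda> where "\<Lambda> = {L. connecting (verts A) ?V L}"
  define w where "w = (\<lambda>(g :: 'a \<Rightarrow> nat) L. real n powr (- (\<epsilon> * \<delta>)) * (\<Prod>e\<in>L. 1 / edge_length g e))"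
  have AV: "verts A \<subseteq> ?V" using i unfolding less_i_def le_i_def le_ind_def by simp
  have E: "\<forall>e\<in>edges B. e \<subseteq> ?V \<and> card e = 2" and finV: "finite ?V"
    using fin unfolding finite_sgraph_def by auto
  have \<Lambda>: "\<Lambda> \<subseteq> Pow (Pow ?V)" unfolding \<Lambda>_def connecting_def by blast
  then have fin\<Lambda>: "finite \<Lambda>" using finV finite_subset by blast
  have w: "0 \<le> w g L" for g L
    unfolding w_def by (intro mult_nonneg_nonneg prod_nonneg ballI inverse_edge_length_nonneg) simp
  have "extension_prob \<alpha> A B g \<le> (\<Sum>L\<in>\<Lambda>. w g L)" if g: "g \<in> ?S" for g
  proof -
    have inj: "inj_on g ?V"
      and far: "\<forall>x\<in>new_verts A B. \<forall>y\<in>verts A. real n powr \<epsilon> \<le> \<bar>real (g x) - real (g y)\<bar>"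
      using g unfolding single_extensions_def by auto
    obtain L where L: "connecting (verts A) ?V L"
      "(\<Prod>e\<in>{e \<in> edges B. \<not> e \<subseteq> verts A}. edge_length g e powr (- \<alpha>)) \<le> w g L"
      using edge_product_le_link_product[OF fin i nonneg a weight inj n far]
      unfolding w_def by blast
    have "extension_prob \<alpha> A B g
        \<le> (\<Prod>e\<in>{e \<in> edges B. \<not> e \<subseteq> verts A}. edge_length g e powr (- \<alpha>))"
      unfolding extension_prob_def
    proof (intro prod_mono conjI edge_prob_nonneg)
      fix e assume "e \<in> {e \<in> edges B. \<not> e \<subseteq> verts A}"
      then have "1 \<le> edge_length g e"
        using E inj_on_subset[OF inj] by (intro edge_length_ge_1) auto
      then show "edge_prob \<alpha> (Max (g ` e) - Min (g ` e)) \<le> edge_length g e powr (- \<alpha>)"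
        unfolding edge_length_def using nonneg by (intro edge_prob_le_powr) auto
    qed
    also have "\<dots> \<le> w g L" by (rule L)
    also have "\<dots> \<le> (\<Sum>L\<in>\<Lambda>. w g L)"
      using L(1) w fin\<Lambda> by (intro member_le_sum) (auto simp: \<Lambda>_def)
    finally show ?thesis .
  qed
  then have "(\<Sum>g\<in>?S. extension_prob \<alpha> A B g) \<le> (\<Sum>g\<in>?S. \<Sum>L\<in>\<Lambda>. w g L)"
    by (rule sum_mono)
  \<comment> \<open>Dropping injectivity and farness leaves a full product of positions.\<close>
  also have "\<dots> \<le> (\<Sum>g\<in>?T. \<Sum>L\<in>\<Lambda>. w g L)"
  proof (intro sum_mono2 sum_nonneg w)
    show "finite ?T" using finV by (intro finite_PiE) auto
    show "?S \<subseteq> ?T" unfolding single_extensions_def by (auto simp: PiE_def Pi_def)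
  qed
  also have "\<dots> = (\<Sum>L\<in>\<Lambda>. real n powr (- (\<epsilon> * \<delta>)) * (\<Sum>g\<in>?T. \<Prod>e\<in>L. 1 / edge_length g e))"
    unfolding w_def by (subst sum.swap) (simp only: sum_distrib_left)
  also have "\<dots> \<le> (\<Sum>L\<in>\<Lambda>. real n powr (- (\<epsilon> * \<delta>)) * (2 * harm n) ^ card (new_verts A B))"
    unfolding new_verts_def \<Lambda>_def
    by (intro sum_mono mult_left_mono sum_link_product_le[OF finV AV _ f]) auto
  also have "\<dots> = real (card \<Lambda>) * (real n powr (- (\<epsilon> * \<delta>)) * (2 * harm n) ^ card (new_verts A B))"
    by simp
  also have "\<dots> \<le> real (card (Pow (Pow ?V))) * (real n powr (- (\<epsilon> * \<delta>)) * (2 * harm n) ^ card (new_verts A B))"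
    using card_mono[OF _ \<Lambda>] finV by (intro mult_right_mono) (auto simp: harm_nonneg)
  finally show ?thesis .
qed

text \<open>A new edge has a vertex outside \<open>A\<close>, whose image in one copy is met by no
  other copy. Hence the images of new edges in all copies are distinct pairs, and their presence is
  independent.\<close>

lemma prob_disjoint_extensions:
  assumes fin: "finite_sgraph B" and \<alpha>: "0 \<le> \<alpha>"
    and g: "\<And>l. l < k \<Longrightarrow> g l \<in> single_extensions \<epsilon> n A B f"
    and AV: "verts A \<subseteq> verts B"
    and disj: "\<And>l m. l < k \<Longrightarrow> m < k \<Longrightarrow> l \<noteq> m \<Longrightarrow> g l ` verts B \<inter> g m ` verts B = f ` verts A"
  shows "measure_pmf.prob (random_graph \<alpha> n)
      {M. \<forall>l<k. \<forall>e\<in>edges B. \<not> e \<subseteq> verts A \<longrightarrow> g l ` e \<in> edges M}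
    = (\<Prod>l<k. extension_prob \<alpha> A B (g l))"
proof -
  define E' where "E' = {e \<in> edges B. \<not> e \<subseteq> verts A}"
  define \<phi> where "\<phi> = (\<lambda>(l, e). g l ` e)"
  have E': "e \<subseteq> verts B" "card e = 2" if "e \<in> E'" for e
    using fin that unfolding finite_sgraph_def E'_def by auto
  have gB: "g l \<in> verts B \<rightarrow> {1..n}" and inj: "inj_on (g l) (verts B)"
    and gA: "\<And>x. x \<in> verts A \<Longrightarrow> g l x = f x" if "l < k" for l
    using g[OF that] unfolding single_extensions_def by auto
  have "l = m \<and> e = d" if lm: "l < k" "m < k" "e \<in> E'" "d \<in> E'" "g l ` e = g m ` d" for l m e d
  proof (cases "l = m")
    case True
    then show ?thesis using lm inj E'(1) by (metis inj_on_image_eq_iff)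
  next
    case False
    obtain x where x: "x \<in> e" "x \<in> verts B" "x \<notin> verts A" using lm(3) E'(1) unfolding E'_def by blast
    have "g l x \<in> g m ` verts B" using x lm E'(1)[of d] by blast
    then have "g l x \<in> f ` verts A" using disj[OF lm(1,2) False] x by blast
    then obtain y where "y \<in> verts A" "g l x = g l y" using gA[OF lm(1)] by auto
    then show ?thesis using inj[OF lm(1)] x AV by (metis inj_onD subsetD)
  qed
  then have inj\<phi>: "inj_on \<phi> ({..<k} \<times> E')" unfolding \<phi>_def by (auto intro!: inj_onI)
  have "g l ` e \<in> vertex_pairs n" if "l < k" "e \<in> E'" for l e
    using gB[OF that(1)] E'[OF that(2)] card_image[OF inj_on_subset[OF inj[OF that(1)] E'(1)[OF that(2)]]]
    unfolding vertex_pairs_def by auto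
  then have "\<phi> ` ({..<k} \<times> E') \<subseteq> vertex_pairs n" unfolding \<phi>_def by auto
  note prob_edges_present[OF \<alpha> this]
  also have "(\<Prod>e\<in>\<phi> ` ({..<k} \<times> E'). edge_prob \<alpha> (Max e - Min e))
      = (\<Prod>(l, e)\<in>{..<k} \<times> E'. edge_prob \<alpha> (Max (g l ` e) - Min (g l ` e)))"
    by (subst prod.reindex[OF inj\<phi>]) (simp add: \<phi>_def case_prod_unfold)
  also have "\<dots> = (\<Prod>l<k. extension_prob \<alpha> A B (g l))"
    unfolding extension_prob_def E'_def by (simp add: prod.cartesian_product)
  finally show ?thesis by (simp add: \<phi>_def E'_def image_subset_iff Ball_def imp_conjL)
qed

text \<open>A union bound runs over \<open>f\<close> and over tuples of disjoint copies. Once the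
  probabilities have factored, disjointness is dropped, and the sum over all tuples is the
  \<open>k\<close>-th power of the sum over single copies.\<close>

lemma prob_far_extensions_le:
  fixes A B :: "'a sgraph"
  assumes fin: "finite_sgraph B" and AV: "verts A \<subseteq> verts B" and \<alpha>: "0 \<le> \<alpha>"
    and b: "\<And>f. f \<in> verts A \<rightarrow> {1..n} \<Longrightarrow> (\<Sum>g\<in>single_extensions \<epsilon> n A B f. extension_prob \<alpha> A B g) \<le> b"
  shows "measure_pmf.prob (random_graph \<alpha> n)
      {M. \<exists>f \<in> verts A \<rightarrow>\<^sub>E {1..n}. far_extensions \<epsilon> k A B n f M \<noteq> {}}
    \<le> real n ^ card (verts A) * b ^ k"
proof -
  let ?F = "verts A \<rightarrow>\<^sub>E {1..n}"
  let ?P = "measure_pmf.prob (random_graph \<alpha> n)"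
  define T where "T = (\<lambda>f. {..<k} \<rightarrow>\<^sub>E single_extensions \<epsilon> n A B f)"
  define D where "D = (\<lambda>f. {g \<in> T f. \<forall>l<k. \<forall>m<k. l \<noteq> m \<longrightarrow> g l ` verts B \<inter> g m ` verts B = f ` verts A})"
  define X where "X = (\<lambda>g :: nat \<Rightarrow> 'a \<Rightarrow> nat. {M. \<forall>l<k. \<forall>e\<in>edges B. \<not> e \<subseteq> verts A \<longrightarrow> g l ` e \<in> edges M})"
  have finV: "finite (verts B)" using fin unfolding finite_sgraph_def by simp
  have finA: "finite (verts A)" using AV finV finite_subset by blast
  have finF: "finite ?F" using finA by (intro finite_PiE) auto
  have finS: "finite (single_extensions \<epsilon> n A B f)" for f
    using finite_subset[of _ "verts B \<rightarrow>\<^sub>E {1..n}"] finV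
    unfolding single_extensions_def by (simp add: finite_PiE)
  have finT: "finite (T f)" for f unfolding T_def using finS by (intro finite_PiE) auto
  have finD: "finite (D f)" for f using finT unfolding D_def by simp
  have "{M. \<exists>f\<in>?F. far_extensions \<epsilon> k A B n f M \<noteq> {}} \<subseteq> (\<Union>f\<in>?F. \<Union>g\<in>D f. X g)"
  proof
    fix M assume "M \<in> {M. \<exists>f\<in>?F. far_extensions \<epsilon> k A B n f M \<noteq> {}}"
    then obtain f g where f: "f \<in> ?F" and g: "g \<in> far_extensions \<epsilon> k A B n f M" by blast
    have "g \<in> D f" using g unfolding far_extensions_def D_def T_def single_extensions_def
      by (auto simp: PiE_iff)
    moreover have "M \<in> X g" using g unfolding far_extensions_def X_def by auto
    ultimately show "M \<in> (\<Union>f\<in>?F. \<Union>g\<in>D f. X g)" using f by blast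
  qed
  then have "?P {M. \<exists>f\<in>?F. far_extensions \<epsilon> k A B n f M \<noteq> {}} \<le> ?P (\<Union>f\<in>?F. \<Union>g\<in>D f. X g)"
    by (intro measure_pmf.finite_measure_mono) auto
  also have "\<dots> \<le> (\<Sum>f\<in>?F. ?P (\<Union>g\<in>D f. X g))"
    using finF by (intro measure_UNION_le) auto
  also have "\<dots> \<le> (\<Sum>f\<in>?F. \<Sum>g\<in>D f. ?P (X g))"
    using finD by (intro sum_mono measure_UNION_le) auto
  also have "\<dots> = (\<Sum>f\<in>?F. \<Sum>g\<in>D f. \<Prod>l<k. extension_prob \<alpha> A B (g l))"
  proof (intro sum.cong refl)
    fix f g assume "g \<in> D f"
    then show "?P (X g) = (\<Prod>l<k. extension_prob \<alpha> A B (g l))"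
      unfolding X_def D_def T_def by (intro prob_disjoint_extensions[OF fin \<alpha> _ AV]) auto
  qed
  also have "\<dots> \<le> (\<Sum>f\<in>?F. \<Sum>g\<in>T f. \<Prod>l<k. extension_prob \<alpha> A B (g l))"
    using finT by (intro sum_mono sum_mono2 prod_nonneg ballI extension_prob_nonneg) (auto simp: D_def)
  also have "\<dots> = (\<Sum>f\<in>?F. (\<Sum>g\<in>single_extensions \<epsilon> n A B f. extension_prob \<alpha> A B g) ^ k)"
    unfolding T_def by (subst prod_sum_PiE[symmetric]) (use finS in auto)
  also have "\<dots> \<le> (\<Sum>f\<in>?F. b ^ k)"
    by (intro sum_mono power_mono b sum_nonneg extension_prob_nonneg) auto
  also have "\<dots> = real n ^ card (verts A) * b ^ k" using finA by (simp add: card_funcsetE)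
  finally show ?thesis .
qed

section \<open>Choice of \<open>k\<close> and the limit\<close>

lemma polylog_times_negative_power_tendsto_0:
  fixes \<eta> C :: real
  assumes "0 < \<eta>"
  shows "(\<lambda>n::nat. C * (real n powr (- \<eta>) * (2 * (ln (real n) + 1)) ^ N)) \<longlonglongrightarrow> 0"
  using assms by real_asymp

text \<open>\<open>harm n - ln n\<close> is decreasing and equals 1 at \<open>n = 1\<close>.\<close>

lemma harm_le_ln_plus_1: "1 \<le> n \<Longrightarrow> harm n \<le> ln (real n) + 1"
  using euler_mascheroni_sequence_decreasing[of 1 n] by (simp add: harm_def)

lemma prob_far_extensions_tendsto_0:
  fixes A B :: "'a sgraph"
  assumes fin: "finite_sgraph B" and i: "less_i \<alpha> A B" and \<alpha>: "0 \<le> \<alpha>" and \<epsilon>: "0 < \<epsilon>"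
  shows "\<exists>k. (\<lambda>n. measure_pmf.prob (random_graph \<alpha> n)
      {M. \<exists>f \<in> verts A \<rightarrow>\<^sub>E {1..n}. far_extensions \<epsilon> k A B n f M \<noteq> {}}) \<longlonglongrightarrow> 0"
proof -
  obtain a where a: "a \<in> verts A" using less_i_verts_nonempty[OF fin i] by blast
  obtain \<delta> :: real where \<delta>: "\<delta> > 0" and
    weight: "\<forall>c :: 'a \<Rightarrow> 'a. (\<forall>x\<in>verts A. c x = c a) \<longrightarrow> (\<exists>x\<in>verts B. c x \<noteq> c a) \<longrightarrow>
      real (card (c ` verts B)) - 1 + \<delta> \<le> \<alpha> * real (card (separated (edges B) c))"
    using uniform_weight_gap[OF fin i a] by blast
  have AV: "verts A \<subseteq> verts B" using i unfolding less_i_def le_i_def le_ind_def by simp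
  \<comment> \<open>One half of the exponent \<open>\<epsilon> * \<delta>\<close> absorbs the
    constant and the logarithms, the other half remains as decay.\<close>
  define \<eta> where "\<eta> = \<epsilon> * \<delta> / 2"
  define d where "d = card (verts A)"
  define N where "N = card (new_verts A B)"
  define C where "C = real (card (Pow (Pow (verts B))))"
  have \<eta>: "\<eta> > 0" using \<epsilon> \<delta> unfolding \<eta>_def by simp
  \<comment> \<open>With \<open>k * \<eta> \<ge> d + 1\<close> the decay of \<open>k\<close> copies
    beats the \<open>n ^ d\<close> maps \<open>f\<close> by a factor \<open>1 / n\<close>.\<close>
  obtain k :: nat where k: "(real d + 1) / \<eta> \<le> real k" using real_arch_simple by blast
  let ?P = "\<lambda>n. measure_pmf.prob (random_graph \<alpha> n)
      {M. \<exists>f \<in> verts A \<rightarrow>\<^sub>E {1..n}. far_extensions \<epsilon> k A B n f M \<noteq> {}}"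
  have "eventually (\<lambda>n. C * (real n powr (- \<eta>) * (2 * (ln (real n) + 1)) ^ N) < 1) sequentially"
    by (rule order_tendstoD(2)[OF polylog_times_negative_power_tendsto_0[OF \<eta>]]) simp
  then have "eventually (\<lambda>n. ?P n \<le> 1 / real n) sequentially"
    using eventually_ge_at_top[of 1]
  proof eventually_elim
    case (elim n)
    let ?b = "C * (real n powr (- (\<epsilon> * \<delta>)) * (2 * harm n) ^ N)"
    have "0 \<le> C" unfolding C_def by simp
    have "C * (real n powr (- \<eta>) * (2 * harm n) ^ N)
        \<le> C * (real n powr (- \<eta>) * (2 * (ln (real n) + 1)) ^ N)"
      using harm_le_ln_plus_1[OF elim(2)] \<open>0 \<le> C\<close>
      by (intro mult_left_mono power_mono) (auto simp: harm_nonneg)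
    with elim(1) have small: "C * (real n powr (- \<eta>) * (2 * harm n) ^ N) \<le> 1" by linarith
    have "real n powr (- (\<epsilon> * \<delta>)) = real n powr (- \<eta>) * real n powr (- \<eta>)"
      unfolding \<eta>_def by (simp add: powr_add[symmetric] mult.commute)
    then have "?b = (C * (real n powr (- \<eta>) * (2 * harm n) ^ N)) * real n powr (- \<eta>)"
      by simp
    also have "\<dots> \<le> 1 * real n powr (- \<eta>)" using small by (intro mult_right_mono) auto
    finally have b: "?b \<le> real n powr (- \<eta>)" by simp
    have "?P n \<le> real n ^ d * ?b ^ k"
      unfolding d_def C_def N_def
      using sum_extension_prob_le[OF fin i \<alpha> _ a weight elim(2)] \<delta>
      by (intro prob_far_extensions_le[OF fin AV \<alpha>]) auto
    also have "\<dots> \<le> real n ^ d * (real n powr (- \<eta>)) ^ k"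
      using b \<open>0 \<le> C\<close> by (intro mult_left_mono power_mono) (auto simp: harm_nonneg)
    also have "(real n powr (- \<eta>)) ^ k = real n powr (- (\<eta> * real k))"
      using elim(2) by (simp add: powr_power mult.commute)
    also have "\<dots> \<le> real n powr (- (real d + 1))"
      using k \<eta> elim(2) by (intro powr_mono) (auto simp: field_simps)
    also have "real n ^ d * real n powr (- (real d + 1)) = real n powr (real d + - (real d + 1))"
      using elim(2) by (simp only: powr_add) (simp add: powr_realpow)
    also have "\<dots> = 1 / real n" using elim(2) by (simp add: powr_minus_divide)
    finally show ?case by (simp add: mult_left_mono)
  qed
  then have "?P \<longlonglongrightarrow> 0"
    by (intro tendsto_sandwich[OF _ _ tendsto_const lim_1_over_n]) auto
  then show ?thesis by blast
qed

section \<open>From the intermediate graph to \<open>B\<close>\<close>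

text \<open>Restricted copies still meet exactly in the image of \<open>A\<close>, since all of them
  agree with \<open>f\<close> there. Hence excluding \<open>k\<close> copies of \<open>A'\<close>
  excludes \<open>k\<close> copies of \<open>B\<close>.\<close>

lemma far_extensions_restrict:
  assumes AA': "verts A \<subseteq> verts A'" and A'B: "A' \<le>\<^sup>* B"
    and g: "g \<in> far_extensions \<epsilon> k A B n f M"
  shows "(\<lambda>l\<in>{..<k}. restrict (g l) (verts A')) \<in> far_extensions \<epsilon> k A A' n f M"
proof -
  have sub: "verts A' \<subseteq> verts B" and E: "edges A' = {e \<in> edges B. e \<subseteq> verts A'}"
    using A'B unfolding le_ind_def by auto
  have g0: "g \<in> {..<k} \<rightarrow>\<^sub>E (verts B \<rightarrow>\<^sub>E {1..n})"
    and g1: "\<And>l. l < k \<Longrightarrow> inj_on (g l) (verts B)"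
    and g2: "\<And>l x. l < k \<Longrightarrow> x \<in> verts A \<Longrightarrow> g l x = f x"
    and g3: "\<And>l e. l < k \<Longrightarrow> e \<in> edges B \<Longrightarrow> \<not> e \<subseteq> verts A \<Longrightarrow> g l ` e \<in> edges M"
    and g4: "\<And>l x y. l < k \<Longrightarrow> x \<in> new_verts A B \<Longrightarrow> y \<in> verts A \<Longrightarrow>
      \<bar>real (g l x) - real (g l y)\<bar> \<ge> real n powr \<epsilon>"
    and g5: "\<And>l m. l < k \<Longrightarrow> m < k \<Longrightarrow> l \<noteq> m \<Longrightarrow> g l ` verts B \<inter> g m ` verts B = f ` verts A"
    using g unfolding far_extensions_def by auto
  have img: "restrict (g l) (verts A') ` e = g l ` e" if "e \<subseteq> verts A'" for l e
    using that by (intro image_cong) auto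
  have disj: "g l ` verts A' \<inter> g m ` verts A' = f ` verts A" if lm: "l < k" "m < k" "l \<noteq> m" for l m
  proof
    show "g l ` verts A' \<inter> g m ` verts A' \<subseteq> f ` verts A" using g5[OF lm] sub by blast
    show "f ` verts A \<subseteq> g l ` verts A' \<inter> g m ` verts A'"
    proof
      fix z assume "z \<in> f ` verts A"
      then obtain x where "x \<in> verts A'" "z = g l x" "z = g m x"
        using g2[OF lm(1)] g2[OF lm(2)] AA' by auto
      then show "z \<in> g l ` verts A' \<inter> g m ` verts A'" by blast
    qed
  qed
  have "(\<lambda>l\<in>{..<k}. restrict (g l) (verts A')) \<in> {..<k} \<rightarrow>\<^sub>E (verts A' \<rightarrow>\<^sub>E {1..n})"
    using g0 sub by (auto simp: PiE_iff)
  moreover have "inj_on (restrict (g l) (verts A')) (verts A')" if "l < k" for l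
    using inj_on_subset[OF g1[OF that] sub] by simp
  ultimately show ?thesis
    unfolding far_extensions_def
    using g2 g3 g4 disj AA' sub E img by (auto simp: new_verts_def subset_iff)
qed

theorem theorem2p4:
  fixes \<alpha> :: real and A B :: "'a sgraph"
  assumes "0 < \<alpha>" and "\<alpha> < 1" and "\<alpha> \<notin> \<rat>"
    and "finite_sgraph A" and "finite_sgraph B"
    and "A <\<^sup>* B" and "less_a \<alpha> A B"
  shows "\<forall>\<epsilon>>0. \<exists>k::nat.
    (\<lambda>n. measure_pmf.prob (random_graph \<alpha> n)
           {M. \<forall>f \<in> verts A \<rightarrow>\<^sub>E {1..n}. inj_on f (verts A) \<longrightarrow>
                 far_extensions \<epsilon> k A B n f M = {}}) \<longlonglongrightarrow> 1"
proof (intro allI impI)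
  fix \<epsilon> :: real assume \<epsilon>: "0 < \<epsilon>"
  \<comment> \<open>As \<open>A\<close> and \<open>B\<close> differ, \<open>less_s\<close> can only
    fail through \<open>le_s\<close>, and this failure supplies \<open>A'\<close>.\<close>
  obtain A' where A': "less_i \<alpha> A A'" "A' \<le>\<^sup>* B"
    using assms(6,7) unfolding less_a_def less_s_def le_s_def less_ind_def by blast
  have AA': "verts A \<subseteq> verts A'" using A'(1) unfolding less_i_def le_i_def le_ind_def by simp
  have "finite_sgraph A'"
    using assms(5) A'(2) finite_subset unfolding finite_sgraph_def le_ind_def by blast
  from prob_far_extensions_tendsto_0[OF this A'(1) _ \<epsilon>] assms(1) obtain k where
    k: "(\<lambda>n. measure_pmf.prob (random_graph \<alpha> n)
      {M. \<exists>f \<in> verts A \<rightarrow>\<^sub>E {1..n}. far_extensions \<epsilon> k A A' n f M \<noteq> {}}) \<longlonglongrightarrow> 0" by auto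
  let ?bad = "\<lambda>n. {M. \<exists>f \<in> verts A \<rightarrow>\<^sub>E {1..n}. far_extensions \<epsilon> k A A' n f M \<noteq> {}}"
  let ?good = "\<lambda>n. {M. \<forall>f \<in> verts A \<rightarrow>\<^sub>E {1..n}. inj_on f (verts A) \<longrightarrow>
                 far_extensions \<epsilon> k A B n f M = {}}"
  have lower: "1 - measure_pmf.prob (random_graph \<alpha> n) (?bad n)
      \<le> measure_pmf.prob (random_graph \<alpha> n) (?good n)" for n
  proof -
    have "- ?bad n \<subseteq> ?good n" using far_extensions_restrict[OF AA' A'(2)] by blast
    then have "measure_pmf.prob (random_graph \<alpha> n) (- ?bad n)
        \<le> measure_pmf.prob (random_graph \<alpha> n) (?good n)"
      by (intro measure_pmf.finite_measure_mono) auto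
    then show ?thesis
      using measure_pmf.prob_compl[of "?bad n" "random_graph \<alpha> n"] by (simp add: Compl_eq_Diff_UNIV)
  qed
  have "(\<lambda>n. 1 - measure_pmf.prob (random_graph \<alpha> n) (?bad n)) \<longlonglongrightarrow> 1"
    using tendsto_diff[OF tendsto_const[of 1] k] by simp
  then have "(\<lambda>n. measure_pmf.prob (random_graph \<alpha> n) (?good n)) \<longlonglongrightarrow> 1"
    by (rule tendsto_sandwich[OF always_eventually[OF allI[OF lower]]
        always_eventually[OF allI[OF measure_pmf.prob_le_1]] _ tendsto_const])
  then show "\<exists>k. (\<lambda>n. measure_pmf.prob (random_graph \<alpha> n)
           {M. \<forall>f \<in> verts A \<rightarrow>\<^sub>E {1..n}. inj_on f (verts A) \<longrightarrow>
                 far_extensions \<epsilon> k A B n f M = {}}) \<longlonglongrightarrow> 1" by blast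
qed

end
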